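(* Let $\mathscr T=(V,\mathcal E)$ be the directed Cartesian product of locally finite rooted directed trees $\mathscr T_1,\ldots,\mathscr T_d$, of finite joint branching index. Let $S_{\boldsymbol\lambda_{\mathfrak c}}=(S_1,\ldots,S_d)$ be a member of $\mathcal S_{\mathscr T}$ and let $E=\bigcap_{j=1}^d\ker S_j^*$ denote the joint kernel of $S_{\boldsymbol\lambda_{\mathfrak c}}^*$. Then $$\dim E=\sum_{F\in\mathscr P}\sum_{u\in\Omega_F}\prod_{i\in F}(\mathrm{card}(\mathsf{sib}(u_i))-1)=1+\sum_{F\in\mathscr P,\ F\neq\emptyset}\ \sum_{u\in\Omega_F}\prod_{i\in F}(\mathrm{card}(\mathsf{sib}(u_i))-1).$$
   Context: Conventions: $\mathbb N=\{0,1,2,\ldots\}$; $|\alpha|=\sum_j\alpha_j$ for $\alpha\in\mathbb N^d$; empty sums are $0$ and empty products are $1$. $\mathscr P$ is the set of all subsets of $\{1,\ldots,d\}$. Trees: a rooted directed tree is a connected directed graph without circuits in which every vertex has at most one parent and exactly one vertex (the root) has no parent. $\mathsf{Chi}(u)$ is the set of children of $u$; for a non-root $u$, $\mathsf{par}(u)$ is its parent and $\mathsf{sib}(u)=\mathsf{Chi}(\mathsf{par}(u))$ (so $u\in\mathsf{sib}(u)$). All directed trees are assumed countably infinite and leafless (every vertex has at least one child). Locally finite: every $\mathsf{Chi}(u)$ is finite. The depth of $u$ is the length of the path from the root to $u$. Products: for rooted directed trees $\mathscr T_j=(V_j,\mathcal E_j)$ with roots $\mathsf{root}_j$, the directed Cartesian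 product $\mathscr T=(V,\mathcal E)$ has $V=V_1\times\cdots\times V_d$ and $(v,w)\in\mathcal E$ iff there is $k$ with $v_j=w_j$ for $j\neq k$ and $(v_k,w_k)\in\mathcal E_k$. The depth of $v\in V$ is $\mathsf d_v=(\mathsf d_{v_1},\ldots,\mathsf d_{v_d})$, $\mathsf d_{v_j}$ being the depth of $v_j$ in $\mathscr T_j$. $\mathsf{Chi}_j(v)$ is the set of $w\in V$ with $w_i=v_i$ for $i\ne j$ and $w_j\in\mathsf{Chi}(v_j)$. $\mathscr T$ is of finite joint branching index if, for each $j$, the set of depths of the branching vertices of $\mathscr T_j$ (vertices with at least two children) is bounded (possibly empty). Family $\mathcal S_{\mathscr T}$: for a sequence $\mathfrak c:\mathbb N\to(0,\infty)$ put $$\lambda_j(w)=\sqrt{\frac{\mathfrak c(|\mathsf d_v|)}{\mathrm{card}(\mathsf{Chi}_j(v))}}\sqrt{\frac{\mathsf d_{v_j}+1}{|\mathsf d_v|+d}},\quad w\in\mathsf{Chi}_j(v),\ v\in V,\ j=1,\ldots,d.$$ On $l^2(V)$ with orthonormal basis $\{e_v\}_{v\in V}$ of indicator functions, $S_{\boldsymbol\lambda_{\mathfrak c}}=(S_1,\ldots,S_d)$ is the (commuting, bounded if $\mathfrak c$ is bounded) multishift $S_je_v=\sum_{w\in\mathsf{Chi}_j(v)}\lambda_j(w)e_w$. $\mathcal S_{\mathscr T}=\{S_{\boldsymbol\lambda_{\mathfrak c}}:\inf\mathfrak c>0,\ \sup\mathfrak c<\infty\}$. Index sets: for $F\in\mathscr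 P$ let $\Phi_F=\{v\in V: v_j\neq\mathsf{root}_j\text{ if }j\in F,\ v_j=\mathsf{root}_j\text{ if }j\notin F\}$. For $u\in\Phi_F$, $\mathsf{sib}_F(u)$ is the set of $w\in V$ with $w_j\in\mathsf{sib}(u_j)$ for $j\in F$ and $w_j=u_j$ for $j\notin F$. These sets partition $\Phi_F$, and $\Omega_F$ is any set containing exactly one element of each class. *)

theory Defs
  imports "HOL-Analysis.Analysis" "HOL-Library.Function_Algebras"
begin

subsection \<open>Rooted directed trees\<close>

definition rooted_directed_tree :: "'a set \<Rightarrow> 'a rel \<Rightarrow> bool" where
  "rooted_directed_tree V E \<longleftrightarrow>
     E \<subseteq> V \<times> V \<and>
     (\<forall>u\<in>V. \<forall>v\<in>V. (u, v) \<in> (E \<union> E\<inverse>)\<^sup>*) \<and>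
     acyclic E \<and>
     (\<forall>u u' v. (u, v) \<in> E \<longrightarrow> (u', v) \<in> E \<longrightarrow> u = u') \<and>
     (\<exists>!r. r \<in> V \<and> (\<forall>u. (u, r) \<notin> E))"

definition root :: "'a set \<Rightarrow> 'a rel \<Rightarrow> 'a" where
  "root V E = (THE r. r \<in> V \<and> (\<forall>u. (u, r) \<notin> E))"

definition Chi :: "'a rel \<Rightarrow> 'a \<Rightarrow> 'a set" where
  "Chi E u = {v. (u, v) \<in> E}"

definition par :: "'a rel \<Rightarrow> 'a \<Rightarrow> 'a" where
  "par E u = (THE p. (p, u) \<in> E)"

definition sib :: "'a rel \<Rightarrow> 'a \<Rightarrow> 'a set" where
  "sib E u = Chi E (par E u)"

definition depth :: "'a set \<Rightarrow> 'a rel \<Rightarrow> 'a \<Rightarrow> nat" where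
  "depth V E u = (THE n. (root V E, u) \<in> E ^^ n)"

definition leafless :: "'a set \<Rightarrow> 'a rel \<Rightarrow> bool" where
  "leafless V E \<longleftrightarrow> (\<forall>u\<in>V. Chi E u \<noteq> {})"

definition locally_finite :: "'a set \<Rightarrow> 'a rel \<Rightarrow> bool" where
  "locally_finite V E \<longleftrightarrow> (\<forall>u\<in>V. finite (Chi E u))"

text \<open>The condition on \<open>card\<close> expresses branching only for finite sets of children;
  it is used for locally finite trees.\<close>

definition branching :: "'a set \<Rightarrow> 'a rel \<Rightarrow> 'a set" where
  "branching V E = {u \<in> V. 2 \<le> card (Chi E u)}"

subsection \<open>The directed Cartesian product\<close>

text \<open>The \<open>j\<close>-th tree is \<open>(V j, E j)\<close> for \<open>j \<in> {1..d}\<close>; vertices of the product are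
  the extensional functions on \<open>{1..d}\<close>.\<close>

definition prod_verts :: "nat \<Rightarrow> (nat \<Rightarrow> 'a set) \<Rightarrow> (nat \<Rightarrow> 'a) set" where
  "prod_verts d V = (\<Pi>\<^sub>E j\<in>{1..d}. V j)"

definition Chi_prod ::
  "nat \<Rightarrow> (nat \<Rightarrow> 'a set) \<Rightarrow> (nat \<Rightarrow> 'a rel) \<Rightarrow> nat \<Rightarrow> (nat \<Rightarrow> 'a) \<Rightarrow> (nat \<Rightarrow> 'a) set" where
  "Chi_prod d V E j v =
     {w \<in> prod_verts d V. (\<forall>i\<in>{1..d} - {j}. w i = v i) \<and> w j \<in> Chi (E j) (v j)}"

definition total_depth ::
  "nat \<Rightarrow> (nat \<Rightarrow> 'a set) \<Rightarrow> (nat \<Rightarrow> 'a rel) \<Rightarrow> (nat \<Rightarrow> 'a) \<Rightarrow> nat" where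
  "total_depth d V E v = (\<Sum>j\<in>{1..d}. depth (V j) (E j) (v j))"

definition finite_joint_branching_index ::
  "nat \<Rightarrow> (nat \<Rightarrow> 'a set) \<Rightarrow> (nat \<Rightarrow> 'a rel) \<Rightarrow> bool" where
  "finite_joint_branching_index d V E \<longleftrightarrow>
     (\<forall>j\<in>{1..d}. bdd_above (depth (V j) (E j) ` branching (V j) (E j)))"

subsection \<open>The index sets\<close>

definition Phi ::
  "nat \<Rightarrow> (nat \<Rightarrow> 'a set) \<Rightarrow> (nat \<Rightarrow> 'a rel) \<Rightarrow> nat set \<Rightarrow> (nat \<Rightarrow> 'a) set" where
  "Phi d V E F =
     {v \<in> prod_verts d V. \<forall>j\<in>{1..d}.
        (j \<in> F \<longrightarrow> v j \<noteq> root (V j) (E j)) \<and> (j \<notin> F \<longrightarrow> v j = root (V j) (E j))}"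

definition sib_prod ::
  "nat \<Rightarrow> (nat \<Rightarrow> 'a set) \<Rightarrow> (nat \<Rightarrow> 'a rel) \<Rightarrow> nat set \<Rightarrow> (nat \<Rightarrow> 'a) \<Rightarrow> (nat \<Rightarrow> 'a) set" where
  "sib_prod d V E F u =
     {w \<in> prod_verts d V. \<forall>j\<in>{1..d}.
        (j \<in> F \<longrightarrow> w j \<in> sib (E j) (u j)) \<and> (j \<notin> F \<longrightarrow> w j = u j)}"

definition is_Omega ::
  "nat \<Rightarrow> (nat \<Rightarrow> 'a set) \<Rightarrow> (nat \<Rightarrow> 'a rel) \<Rightarrow> nat set \<Rightarrow> (nat \<Rightarrow> 'a) set \<Rightarrow> bool" where
  "is_Omega d V E F \<Omega> \<longleftrightarrow>
     \<Omega> \<subseteq> Phi d V E F \<and> (\<forall>u\<in>Phi d V E F. \<exists>!w. w \<in> \<Omega> \<and> w \<in> sib_prod d V E F u)"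

subsection \<open>The Hilbert space \<open>l\<^sup>2(X)\<close>\<close>

text \<open>Elements are represented by functions vanishing outside \<open>X\<close>; an operator is a
  function on all of \<^typ>\<open>'v \<Rightarrow> complex\<close> of which only the values on \<open>l2 X\<close> matter.\<close>

definition l2 :: "'v set \<Rightarrow> ('v \<Rightarrow> complex) set" where
  "l2 X = {f. (\<forall>x. x \<notin> X \<longrightarrow> f x = 0) \<and> (\<lambda>x. (cmod (f x))\<^sup>2) summable_on X}"

definition l2_inner :: "'v set \<Rightarrow> ('v \<Rightarrow> complex) \<Rightarrow> ('v \<Rightarrow> complex) \<Rightarrow> complex" where
  "l2_inner X f g = (\<Sum>\<^sub>\<infinity>x\<in>X. f x * cnj (g x))"

text \<open>For bounded \<open>T\<close> on \<open>l2 X\<close> the vector described here exists and is unique.\<close>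

definition l2_adjoint ::
  "'v set \<Rightarrow> (('v \<Rightarrow> complex) \<Rightarrow> ('v \<Rightarrow> complex)) \<Rightarrow> ('v \<Rightarrow> complex) \<Rightarrow> ('v \<Rightarrow> complex)" where
  "l2_adjoint X T g =
     (THE h. h \<in> l2 X \<and> (\<forall>f\<in>l2 X. l2_inner X (T f) g = l2_inner X f h))"

definition cscale :: "complex \<Rightarrow> ('v \<Rightarrow> complex) \<Rightarrow> ('v \<Rightarrow> complex)" where
  "cscale a f = (\<lambda>x. a * f x)"

global_interpretation cfun: vector_space "cscale :: complex \<Rightarrow> ('v \<Rightarrow> complex) \<Rightarrow> _"
  by unfold_locales (auto simp: cscale_def fun_eq_iff algebra_simps)

text \<open>\<^term>\<open>cfun.dim\<close> is \<open>0\<close> on infinite-dimensional spaces, hence the case distinction.\<close>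

definition cdimension :: "('v \<Rightarrow> complex) set \<Rightarrow> enat" where
  "cdimension W =
     (if \<exists>B. finite B \<and> W \<subseteq> cfun.span B then enat (cfun.dim W) else \<infinity>)"

subsection \<open>Multishifts\<close>

text \<open>The weight \<open>\<lambda>\<^sub>j(w)\<close> at \<open>w \<in> Chi_prod d V E j v\<close>; there
  \<open>v = w(j := par (E j) (w j))\<close> is determined by \<open>w\<close>.\<close>

definition weight ::
  "nat \<Rightarrow> (nat \<Rightarrow> 'a set) \<Rightarrow> (nat \<Rightarrow> 'a rel) \<Rightarrow> (nat \<Rightarrow> real) \<Rightarrow> nat \<Rightarrow> (nat \<Rightarrow> 'a) \<Rightarrow> real" where
  "weight d V E c j w =
     (let v = w(j := par (E j) (w j)) in
        sqrt (c (total_depth d V E v) / real (card (Chi_prod d V E j v))) *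
        sqrt ((real (depth (V j) (E j) (v j)) + 1) / (real (total_depth d V E v) + real d)))"

text \<open>The linear extension of \<open>S\<^sub>j e\<^sub>v = (\<Sum>w\<in>Chi\<^sub>j(v). \<lambda>\<^sub>j(w) e\<^sub>w)\<close> to \<open>f = (\<Sum>v. f(v) e\<^sub>v)\<close>,
  evaluated pointwise; at each point at most one \<open>v\<close> contributes.\<close>

definition multishift ::
  "nat \<Rightarrow> (nat \<Rightarrow> 'a set) \<Rightarrow> (nat \<Rightarrow> 'a rel) \<Rightarrow> (nat \<Rightarrow> real) \<Rightarrow> nat \<Rightarrow>
     ((nat \<Rightarrow> 'a) \<Rightarrow> complex) \<Rightarrow> ((nat \<Rightarrow> 'a) \<Rightarrow> complex)" where
  "multishift d V E c j f =
     (\<lambda>x. \<Sum>\<^sub>\<infinity>v\<in>prod_verts d V.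
        f v * (\<Sum>w\<in>Chi_prod d V E j v. complex_of_real (weight d V E c j w) * indicator {w} x))"

lemma multishift_basis:
  assumes "v \<in> prod_verts d V"
  shows "multishift d V E c j (indicator {v}) =
    (\<Sum>w\<in>Chi_prod d V E j v. cscale (complex_of_real (weight d V E c j w)) (indicator {w}))"
proof
  fix x
  have ev: "(\<Sum>w\<in>A. g w) x = (\<Sum>w\<in>A. g w x)"
    for A and g :: "(nat \<Rightarrow> 'a) \<Rightarrow> (nat \<Rightarrow> 'a) \<Rightarrow> complex"
    by (induction A rule: infinite_finite_induct) auto
  let ?h = "\<lambda>u. (\<Sum>w\<in>Chi_prod d V E j u. complex_of_real (weight d V E c j w) * indicator {w} x)"
  have "multishift d V E c j (indicator {v}) x =
      (\<Sum>\<^sub>\<infinity>u\<in>prod_verts d V. indicator {v} u * ?h u)"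
    by (simp add: multishift_def)
  also have "\<dots> = (\<Sum>\<^sub>\<infinity>u\<in>{v}. indicator {v} u * ?h u)"
    by (rule infsum_cong_neutral) (use assms in \<open>auto simp: indicator_def\<close>)
  also have "\<dots> = ?h v" by simp
  finally show "multishift d V E c j (indicator {v}) x =
    (\<Sum>w\<in>Chi_prod d V E j v. cscale (complex_of_real (weight d V E c j w)) (indicator {w})) x"
    by (simp add: ev cscale_def)
qed

definition multishift_family ::
  "nat \<Rightarrow> (nat \<Rightarrow> 'a set) \<Rightarrow> (nat \<Rightarrow> 'a rel) \<Rightarrow>
     (nat \<Rightarrow> ((nat \<Rightarrow> 'a) \<Rightarrow> complex) \<Rightarrow> ((nat \<Rightarrow> 'a) \<Rightarrow> complex)) set" where
  "multishift_family d V E =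
     {multishift d V E c | c. (\<forall>n. 0 < c n) \<and> 0 < (INF n. c n) \<and> bdd_above (range c)}"

definition joint_kernel_adj ::
  "nat \<Rightarrow> 'v set \<Rightarrow> (nat \<Rightarrow> ('v \<Rightarrow> complex) \<Rightarrow> ('v \<Rightarrow> complex)) \<Rightarrow> ('v \<Rightarrow> complex) set" where
  "joint_kernel_adj d X S = {g \<in> l2 X. \<forall>j\<in>{1..d}. l2_adjoint X (S j) g = 0}"

end

theory Submission
  imports Defs
begin

text \<open>
  The weights \<open>\<lambda>\<^sub>j\<close> are positive and constant on each \<open>Chi\<^sub>j(v)\<close>, so \<open>g\<close> lies in the joint kernel
  of the adjoints iff its sum over every \<open>Chi\<^sub>j(v)\<close> vanishes. Fix a representative in every sibling
  set of every tree, and let \<open>B\<close> be the set of those \<open>b \<in> V\<close> none of whose non-root coordinates is a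
  representative. The vanishing sums determine \<open>g\<close> from its restriction to \<open>B\<close>, by induction on the
  number of coordinates that are representatives; conversely the tensor products over \<open>j\<close> of
  \<open>\<delta>\<^bsub>b\<^sub>j\<^esub> - \<delta>\<^bsub>rep(b\<^sub>j)\<^esub>\<close> (or \<open>\<delta>\<^bsub>root\<^esub>\<close> if \<open>b\<^sub>j\<close> is the root) lie in the kernel and restrict to the
  indicator functions on \<open>B\<close>. Hence the dimension is \<open>card B\<close>. A non-root vertex that is not a
  representative has a branching parent, so \<open>B\<close> is finite, and it meets the class \<open>sib\<^sub>F(u)\<close> in
  \<open>\<Prod>i\<in>F. (card (sib(u\<^sub>i)) - 1)\<close> points.
\<close>

subsection \<open>Adjoints of weighted shifts\<close>

lemma l2_D: "f \<in> l2 X \<Longrightarrow> x \<notin> X \<Longrightarrow> f x = 0"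
  and l2_summable: "f \<in> l2 X \<Longrightarrow> (\<lambda>x. (cmod (f x))\<^sup>2) summable_on X"
  by (auto simp: l2_def)

lemma finite_support_in_l2:
  assumes "finite {x. f x \<noteq> 0}" and "{x. f x \<noteq> 0} \<subseteq> X"
  shows "f \<in> l2 X"
proof -
  have "(\<lambda>x. (cmod (f x))\<^sup>2) summable_on X \<longleftrightarrow> (\<lambda>x. (cmod (f x))\<^sup>2) summable_on {x. f x \<noteq> 0}"
    using assms(2) by (intro summable_on_cong_neutral) auto
  then show ?thesis using assms by (auto simp: l2_def)
qed

lemma l2_inner_indicator:
  assumes "v \<in> X"
  shows "l2_inner X (indicator {v}) h = cnj (h v)"
proof -
  have "l2_inner X (indicator {v}) h = (\<Sum>\<^sub>\<infinity>x\<in>{v}. indicator {v} x * cnj (h x))"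
    unfolding l2_inner_def using assms by (intro infsum_cong_neutral) (auto simp: indicator_def)
  then show ?thesis by simp
qed

text \<open>Discharges the definite description in \<open>l2_adjoint\<close>: testing against
  indicator functions fixes the vector on \<open>X\<close>, and membership in \<open>l2 X\<close>
  makes it zero elsewhere.\<close>

lemma l2_adjoint_eqI:
  assumes "h \<in> l2 X" and "\<And>f. f \<in> l2 X \<Longrightarrow> l2_inner X (T f) g = l2_inner X f h"
  shows "l2_adjoint X T g = h"
  unfolding l2_adjoint_def
proof (rule the_equality)
  fix k assume k: "k \<in> l2 X \<and> (\<forall>f\<in>l2 X. l2_inner X (T f) g = l2_inner X f k)"
  show "k = h"
  proof
    fix x
    show "k x = h x"
    proof (cases "x \<in> X")
      case True
      have "indicator {x} \<in> l2 X"
        using True by (intro finite_support_in_l2) (auto simp: indicator_def)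
      then have "l2_inner X (indicator {x}) k = l2_inner X (indicator {x}) h"
        using k assms(2) by metis
      then show ?thesis using True by (simp add: l2_inner_indicator)
    next
      case False
      then show ?thesis using k assms(1) l2_D by metis
    qed
  qed
qed (use assms in blast)

text \<open>Since the sets \<open>C v\<close> are disjoint, the inner product of \<open>T f\<close>
  and \<open>g\<close> is a double sum over pairs of a vertex and a child, which can be regrouped by
  parent. The bound \<open>M\<close> enters twice: through Cauchy-Schwarz it puts the candidate
  \<open>?h\<close> into \<open>l2 X\<close>, and it makes the double sum absolutely
  convergent.\<close>

lemma l2_adjoint_weighted_shift:
  fixes X :: "'v set" and C :: "'v \<Rightarrow> 'v set" and l :: "'v \<Rightarrow> real"
  assumes C: "\<And>v. v \<in> X \<Longrightarrow> finite (C v) \<and> C v \<subseteq> X"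
    and disj: "\<And>u v. u \<in> X \<Longrightarrow> v \<in> X \<Longrightarrow> u \<noteq> v \<Longrightarrow> C u \<inter> C v = {}"
    and bound: "\<And>v. v \<in> X \<Longrightarrow> (\<Sum>w\<in>C v. (l w)\<^sup>2) \<le> M"
    and g: "g \<in> l2 X"
  defines "T \<equiv> \<lambda>f x. \<Sum>\<^sub>\<infinity>v\<in>X. f v * (\<Sum>w\<in>C v. complex_of_real (l w) * indicator {w} x)"
  shows "l2_adjoint X T g = (\<lambda>v. if v \<in> X then \<Sum>w\<in>C v. complex_of_real (l w) * g w else 0)"
    (is "_ = ?h")
proof (rule l2_adjoint_eqI)
  \<comment> \<open>By disjointness a child determines its parent, so a sum over children is a sum
    over pairs.\<close>
  have inj: "inj_on snd (Sigma X C)"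
    using disj by (fastforce simp: inj_on_def)
  have sub: "snd ` Sigma X C \<subseteq> X" using C by fastforce
  have coeff: "(\<Sum>w\<in>C v. complex_of_real (l w) * indicator {w} x) = (if x \<in> C v then complex_of_real (l x) else 0)"
    if "v \<in> X" for v x
    using C[OF that] by (simp add: indicator_def if_distrib sum.delta cong: if_cong)
  have g_sum: "(\<lambda>(v, w). (cmod (g w))\<^sup>2) summable_on Sigma X C"
  proof -
    have "(\<lambda>w. (cmod (g w))\<^sup>2) summable_on snd ` Sigma X C"
      using l2_summable[OF g] sub by (rule summable_on_subset_banach)
    then show ?thesis using inj by (simp add: summable_on_reindex o_def case_prod_unfold)
  qed
  show "?h \<in> l2 X"
  proof -
    have "(\<lambda>v. \<Sum>\<^sub>\<infinity>w\<in>C v. (cmod (g w))\<^sup>2) summable_on X"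
      using summable_on_Sigma_banach[OF g_sum] by simp
    then have *: "(\<lambda>v. M * (\<Sum>w\<in>C v. (cmod (g w))\<^sup>2)) summable_on X"
      using C by (intro summable_on_cmult_right) (simp cong: summable_on_cong)
    have "(\<lambda>v. (cmod (?h v))\<^sup>2) summable_on X"
    proof (rule summable_on_comparison_test[OF *])
      fix v assume v: "v \<in> X"
      have "cmod (?h v) \<le> (\<Sum>w\<in>C v. \<bar>l w\<bar> * cmod (g w))"
        using v by (auto intro!: order.trans[OF norm_sum] sum_mono simp: norm_mult)
      then have "(cmod (?h v))\<^sup>2 \<le> (\<Sum>w\<in>C v. \<bar>l w\<bar> * cmod (g w))\<^sup>2"
        by (rule power_mono) simp
      also have "\<dots> \<le> (\<Sum>w\<in>C v. \<bar>l w\<bar>\<^sup>2) * (\<Sum>w\<in>C v. (cmod (g w))\<^sup>2)"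
        by (rule Cauchy_Schwarz_ineq_sum)
      also have "\<dots> \<le> M * (\<Sum>w\<in>C v. (cmod (g w))\<^sup>2)"
        using bound[OF v] by (intro mult_right_mono) (auto intro: sum_nonneg)
      finally show "(cmod (?h v))\<^sup>2 \<le> M * (\<Sum>w\<in>C v. (cmod (g w))\<^sup>2)" .
    qed simp
    then show ?thesis by (simp add: l2_def)
  qed
  fix f :: "'v \<Rightarrow> complex" assume f: "f \<in> l2 X"
  have T_child: "T f w = f v * complex_of_real (l w)" if "v \<in> X" "w \<in> C v" for v w
  proof -
    have "T f w = (\<Sum>\<^sub>\<infinity>u\<in>{v}. f u * complex_of_real (l w))"
      unfolding T_def using that disj[of _ v]
      by (intro infsum_cong_neutral) (auto simp: coeff)
    then show ?thesis by simp
  qed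
  \<comment> \<open>Points that lie in no \<open>C v\<close> receive nothing, so only children count
    in the inner product.\<close>
  have T_other: "T f x = 0" if "x \<notin> snd ` Sigma X C" for x
  proof -
    have "T f x = (\<Sum>\<^sub>\<infinity>u\<in>X. 0)"
      unfolding T_def using that by (intro infsum_cong) (force simp: coeff)
    then show ?thesis by simp
  qed
  \<comment> \<open>Summing the squared weights over \<open>C v\<close> first costs at most the
    factor \<open>M\<close>, which leaves a multiple of the summable squares of
    \<open>f\<close>.\<close>
  have f_sum: "(\<lambda>(v, w). (cmod (f v))\<^sup>2 * (l w)\<^sup>2) summable_on Sigma X C"
  proof (rule summable_on_SigmaI)
    show "((\<lambda>w. case (v, w) of (v, w) \<Rightarrow> (cmod (f v))\<^sup>2 * (l w)\<^sup>2) has_sum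
        (\<Sum>w\<in>C v. (cmod (f v))\<^sup>2 * (l w)\<^sup>2)) (C v)" if "v \<in> X" for v
      using C[OF that] by (simp add: has_sum_finite)
    have *: "(\<lambda>v. (cmod (f v))\<^sup>2 * M) summable_on X"
      by (intro summable_on_cmult_left l2_summable f)
    show "(\<lambda>v. \<Sum>w\<in>C v. (cmod (f v))\<^sup>2 * (l w)\<^sup>2) summable_on X"
      by (rule summable_on_comparison_test[OF *])
        (auto simp flip: sum_distrib_left intro!: mult_left_mono mult_nonneg_nonneg bound sum_nonneg)
  qed auto
  let ?F = "\<lambda>v w. f v * complex_of_real (l w) * cnj (g w)"
  \<comment> \<open>Absolute summability justifies the iterated sum below; 2ab \<le> a^2 + b^2
    bounds each term by the sum of those in \<open>f_sum\<close> and \<open>g_sum\<close>.\<close>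
  have F_sum: "(\<lambda>(v, w). ?F v w) summable_on Sigma X C"
  proof (rule abs_summable_summable, rule Infinite_Sum.abs_summable_on_comparison_test'[OF summable_on_add[OF f_sum g_sum]])
    fix p assume "p \<in> Sigma X C"
    obtain v w where p: "p = (v, w)" by (cases p)
    have "2 * (cmod (f v) * \<bar>l w\<bar>) * cmod (g w) \<le> (cmod (f v) * \<bar>l w\<bar>)\<^sup>2 + (cmod (g w))\<^sup>2"
      by (rule sum_squares_bound)
    moreover have "0 \<le> cmod (f v) * \<bar>l w\<bar> * cmod (g w)" by simp
    ultimately have "cmod (f v) * \<bar>l w\<bar> * cmod (g w) \<le> (cmod (f v) * \<bar>l w\<bar>)\<^sup>2 + (cmod (g w))\<^sup>2"
      by linarith
    then show "norm (case p of (v, w) \<Rightarrow> ?F v w) \<le>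
        (case p of (v, w) \<Rightarrow> (cmod (f v))\<^sup>2 * (l w)\<^sup>2) + (case p of (v, w) \<Rightarrow> (cmod (g w))\<^sup>2)"
      by (simp add: p norm_mult power_mult_distrib)
  qed
  have "l2_inner X (T f) g = (\<Sum>\<^sub>\<infinity>x\<in>snd ` Sigma X C. T f x * cnj (g x))"
    unfolding l2_inner_def using sub T_other by (intro infsum_cong_neutral) auto
  also have "\<dots> = (\<Sum>\<^sub>\<infinity>(v, w)\<in>Sigma X C. T f w * cnj (g w))"
    using inj by (simp add: infsum_reindex o_def case_prod_unfold)
  also have "\<dots> = (\<Sum>\<^sub>\<infinity>(v, w)\<in>Sigma X C. ?F v w)"
    by (intro infsum_cong) (auto simp: T_child)
  also have "\<dots> = (\<Sum>\<^sub>\<infinity>v\<in>X. \<Sum>\<^sub>\<infinity>w\<in>C v. ?F v w)"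
    by (rule infsum_Sigma'_banach[symmetric]) (fact F_sum)
  also have "\<dots> = (\<Sum>\<^sub>\<infinity>v\<in>X. f v * cnj (?h v))"
    using C by (intro infsum_cong) (simp add: sum_distrib_left mult.assoc)
  finally show "l2_inner X (T f) g = l2_inner X f ?h" by (simp add: l2_inner_def)
qed

subsection \<open>Rooted trees\<close>

locale rooted_tree =
  fixes V :: "'a set" and E :: "'a rel"
  assumes rooted: "rooted_directed_tree V E"
begin

lemma edges_subset: "E \<subseteq> V \<times> V"
  and connected: "u \<in> V \<Longrightarrow> v \<in> V \<Longrightarrow> (u, v) \<in> (E \<union> E\<inverse>)\<^sup>*"
  and parent_unique: "(u, v) \<in> E \<Longrightarrow> (u', v) \<in> E \<Longrightarrow> u = u'"
  and ex1_root: "\<exists>!r. r \<in> V \<and> (\<forall>u. (u, r) \<notin> E)"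
  by (insert rooted[unfolded rooted_directed_tree_def], elim conjE, simp_all)

lemma edge_in_verts: "(u, v) \<in> E \<Longrightarrow> u \<in> V \<and> v \<in> V"
  using edges_subset by blast

lemma root_props: "root V E \<in> V \<and> (\<forall>u. (u, root V E) \<notin> E)"
  using theI'[OF ex1_root] unfolding root_def .

lemma root_in_verts: "root V E \<in> V"
  and no_parent_root: "(u, root V E) \<notin> E"
  using root_props by auto

lemma root_unique: "r \<in> V \<Longrightarrow> (\<And>u. (u, r) \<notin> E) \<Longrightarrow> r = root V E"
  using ex1_root root_props by blast

lemma par_eq: "(p, u) \<in> E \<Longrightarrow> par E u = p"
  unfolding par_def using parent_unique by blast

lemma par_edge: "u \<in> V \<Longrightarrow> u \<noteq> root V E \<Longrightarrow> (par E u, u) \<in> E"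
  using root_unique[of u] par_eq by blast

lemma sib_child: "(p, u) \<in> E \<Longrightarrow> sib E u = Chi E p"
  by (simp add: sib_def par_eq)

lemma self_in_sib: "u \<in> V \<Longrightarrow> u \<noteq> root V E \<Longrightarrow> u \<in> sib E u"
  using par_edge by (simp add: sib_def Chi_def)

lemma in_sib:
  assumes "u \<in> V" "u \<noteq> root V E" "w \<in> sib E u"
  shows "w \<in> V" "w \<noteq> root V E" "sib E w = sib E u"
proof -
  have "(par E u, w) \<in> E" using assms(3) by (simp add: sib_def Chi_def)
  then show "w \<in> V" "w \<noteq> root V E" "sib E w = sib E u"
    using edge_in_verts no_parent_root sib_child[of "par E u" w] by (auto simp: sib_def)
qed

text \<open>Connectedness only provides an undirected path. A forward step extends the directed path
  from the root; a backward step leads to the unique parent, which is the last but one vertex of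
  that path.\<close>

lemma reachable: "u \<in> V \<Longrightarrow> (root V E, u) \<in> E\<^sup>*"
proof -
  assume "u \<in> V"
  then have "(root V E, u) \<in> (E \<union> E\<inverse>)\<^sup>*"
    using connected root_in_verts by simp
  then show ?thesis
  proof (induction rule: rtrancl_induct)
    case (step y z)
    from step.hyps(2) show ?case
    proof
      assume "(y, z) \<in> E\<inverse>"
      then have zy: "(z, y) \<in> E" by simp
      then have "y \<noteq> root V E" using no_parent_root by blast
      with step.IH obtain p where p: "(root V E, p) \<in> E\<^sup>*" "(p, y) \<in> E"
        by (cases rule: rtranclE) auto
      with parent_unique[OF zy] show ?thesis by blast
    qed (use step.IH in auto)
  qed simp
qed

text \<open>Peel off last edges: their sources agree because parents are unique, and since the root
  has no parent both paths are exhausted at the same time. This makes the description in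
  \<open>depth\<close> well defined.\<close>

lemma path_length_unique:
  "(root V E, u) \<in> E ^^ n \<Longrightarrow> (root V E, u) \<in> E ^^ m \<Longrightarrow> n = m"
proof (induction n arbitrary: u m)
  case 0
  then show ?case using no_parent_root by (cases m) auto
next
  case (Suc n)
  then obtain p where p: "(root V E, p) \<in> E ^^ n" "(p, u) \<in> E" by auto
  with Suc.prems(2) obtain k where k: "m = Suc k"
    using no_parent_root by (cases m) auto
  with Suc.prems(2) p have "(root V E, p) \<in> E ^^ k"
    by (auto dest: parent_unique[OF p(2)])
  with Suc.IH p k show ?case by blast
qed

lemma depth_path: "u \<in> V \<Longrightarrow> (root V E, u) \<in> E ^^ depth V E u"
proof -
  assume "u \<in> V"
  then obtain n where n: "(root V E, u) \<in> E ^^ n"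
    using reachable rtrancl_imp_relpow by blast
  then show ?thesis unfolding depth_def by (rule theI) (rule path_length_unique[OF _ n])
qed

end

section \<open>Finiteness in locally finite trees\<close>

locale locally_finite_tree = rooted_tree +
  assumes loc_fin: "locally_finite V E"
begin

lemma finite_Chi: "u \<in> V \<Longrightarrow> finite (Chi E u)"
  using loc_fin by (simp add: locally_finite_def)

lemma finite_sib: "u \<in> V \<Longrightarrow> u \<noteq> root V E \<Longrightarrow> finite (sib E u)"
  using par_edge edge_in_verts finite_Chi unfolding sib_def by blast

text \<open>The next sphere is a union of sets of children. Inclusion in \<open>V\<close> is carried
  through the induction because only vertices are known to have finitely many children.\<close>

lemma finite_sphere: "finite {u. (root V E, u) \<in> E ^^ n} \<and> {u. (root V E, u) \<in> E ^^ n} \<subseteq> V"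
proof (induction n)
  case 0
  then show ?case using root_in_verts by simp
next
  case (Suc n)
  have "{u. (root V E, u) \<in> E ^^ Suc n} = (\<Union>p\<in>{u. (root V E, u) \<in> E ^^ n}. Chi E p)"
    by (auto simp: Chi_def)
  then show ?case using Suc finite_Chi edge_in_verts by (auto simp: Chi_def)
qed

text \<open>Bounded depth confines the branching vertices to finitely many finite spheres.\<close>

lemma finite_branching:
  assumes "bdd_above (depth V E ` branching V E)"
  shows "finite (branching V E)"
proof -
  from assms obtain N where "\<forall>u\<in>branching V E. depth V E u \<le> N"
    unfolding bdd_above_def by blast
  then have "branching V E \<subseteq> (\<Union>n\<le>N. {u. (root V E, u) \<in> E ^^ n})"
    using depth_path by (auto simp: branching_def)
  then show ?thesis using finite_sphere by (auto intro: finite_subset)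
qed

end

section \<open>Representatives of sibling sets and free vertices\<close>

definition rep :: "'a rel \<Rightarrow> 'a \<Rightarrow> 'a" where
  "rep E u = (SOME w. w \<in> sib E u)"

definition free_verts :: "'a set \<Rightarrow> 'a rel \<Rightarrow> 'a set" where
  "free_verts V E = {u \<in> V. u \<noteq> root V E \<longrightarrow> u \<noteq> rep E u}"

context rooted_tree
begin

lemma rep_in_sib: "u \<in> V \<Longrightarrow> u \<noteq> root V E \<Longrightarrow> rep E u \<in> sib E u"
  unfolding rep_def using self_in_sib by (rule someI)

text \<open>The choice in \<open>rep\<close> depends only on the set of siblings, which all siblings
  share.\<close>

lemma rep_sib: "u \<in> V \<Longrightarrow> u \<noteq> root V E \<Longrightarrow> w \<in> sib E u \<Longrightarrow> rep E w = rep E u"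
  by (simp add: in_sib(3) rep_def)

lemma root_free: "root V E \<in> free_verts V E"
  by (simp add: free_verts_def root_in_verts)

end

text \<open>A non-root free vertex and its representative are two distinct children of one parent,
  so it is a child of one of the finitely many branching vertices.\<close>

lemma (in locally_finite_tree) finite_free_verts:
  assumes "bdd_above (depth V E ` branching V E)"
  shows "finite (free_verts V E)"
proof -
  have "free_verts V E \<subseteq> insert (root V E) (\<Union>p\<in>branching V E. Chi E p)"
  proof
    fix u assume u: "u \<in> free_verts V E"
    show "u \<in> insert (root V E) (\<Union>p\<in>branching V E. Chi E p)"
    proof (cases "u = root V E")
      case False
      with u have *: "u \<in> V" "u \<noteq> rep E u" by (auto simp: free_verts_def)
      have p: "(par E u, u) \<in> E" using par_edge * False by blast
      then have pV: "par E u \<in> V" using edge_in_verts by blast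
      have "{u, rep E u} \<subseteq> Chi E (par E u)"
        using rep_in_sib[OF *(1) False] self_in_sib[OF *(1) False] by (simp add: sib_def)
      then have "card {u, rep E u} \<le> card (Chi E (par E u))"
        using finite_Chi[OF pV] card_mono by blast
      then have "par E u \<in> branching V E" using * pV by (simp add: branching_def)
      then show ?thesis using p by (auto simp: Chi_def)
    qed simp
  qed
  moreover have "finite (\<Union>p\<in>branching V E. Chi E p)"
    using finite_branching[OF assms] finite_Chi by (auto simp: branching_def)
  ultimately show ?thesis using finite_subset by auto
qed

subsection \<open>The joint kernel\<close>

locale tree_product =
  fixes d :: nat and V :: "nat \<Rightarrow> 'a set" and E :: "nat \<Rightarrow> 'a rel"
  assumes trees: "j \<in> {1..d} \<Longrightarrow> locally_finite_tree (V j) (E j)"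
begin

lemma trees': "j \<in> {1..d} \<Longrightarrow> rooted_tree (V j) (E j)"
  using trees by (auto simp: locally_finite_tree_def)

lemma coord_in_verts: "v \<in> prod_verts d V \<Longrightarrow> j \<in> {1..d} \<Longrightarrow> v j \<in> V j"
  by (auto simp: prod_verts_def)

lemma fun_upd_in_verts:
  "v \<in> prod_verts d V \<Longrightarrow> j \<in> {1..d} \<Longrightarrow> y \<in> V j \<Longrightarrow> v(j := y) \<in> prod_verts d V"
  by (auto simp: prod_verts_def PiE_iff extensional_def)

lemma Chi_prod_eq:
  assumes v: "v \<in> prod_verts d V" and j: "j \<in> {1..d}"
  shows "Chi_prod d V E j v = (\<lambda>y. v(j := y)) ` Chi (E j) (v j)"
proof (intro equalityI subsetI)
  fix w assume w: "w \<in> Chi_prod d V E j v"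
  \<comment> \<open>Outside \<open>{1..d}\<close> both sides are \<open>undefined\<close>, by
    extensionality of product vertices.\<close>
  have "w i = (v(j := w j)) i" for i
    using w v by (cases "i \<in> {1..d}") (auto simp: Chi_prod_def prod_verts_def PiE_iff extensional_def)
  then have "w = v(j := w j)" by blast
  then show "w \<in> (\<lambda>y. v(j := y)) ` Chi (E j) (v j)" using w by (auto simp: Chi_prod_def)
next
  fix w assume "w \<in> (\<lambda>y. v(j := y)) ` Chi (E j) (v j)"
  then obtain y where y: "(v j, y) \<in> E j" "w = v(j := y)" by (auto simp: Chi_def)
  then have "y \<in> V j" using rooted_tree.edge_in_verts[OF trees'[OF j]] by blast
  then show "w \<in> Chi_prod d V E j v"
    using y fun_upd_in_verts[OF v j] by (auto simp: Chi_prod_def Chi_def)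
qed

lemma inj_on_fun_upd: "inj_on (\<lambda>y. v(j := y)) A"
  by (rule inj_onI) (metis fun_upd_same)

lemma sum_Chi_prod:
  assumes "v \<in> prod_verts d V" and "j \<in> {1..d}"
  shows "sum f (Chi_prod d V E j v) = (\<Sum>y\<in>Chi (E j) (v j). f (v(j := y)))"
  using assms by (simp add: Chi_prod_eq sum.reindex inj_on_fun_upd)

lemma finite_Chi_prod:
  assumes "v \<in> prod_verts d V" and "j \<in> {1..d}"
  shows "finite (Chi_prod d V E j v)"
  using assms locally_finite_tree.finite_Chi[OF trees coord_in_verts] by (simp add: Chi_prod_eq)

text \<open>Recovers the vertex from which \<open>weight\<close> is computed, and shows that
  different vertices have disjoint sets of \<open>j\<close>-children.\<close>

lemma parent_of_Chi_prod:
  assumes "v \<in> prod_verts d V" and "j \<in> {1..d}" and "w \<in> Chi_prod d V E j v"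
  shows "w(j := par (E j) (w j)) = v"
  using assms rooted_tree.par_eq[OF trees'] by (auto simp: Chi_prod_eq Chi_def)

text \<open>The weight of a child depends only on its parent \<open>v\<close>, so in the adjoint it
  comes out of the sum over \<open>Chi_prod d V E j v\<close> as a factor \<open>l v\<close>,
  nonzero whenever there are children.\<close>

lemma joint_kernel_multishift:
  assumes pos: "\<And>n. 0 < c n" and bdd: "bdd_above (range c)"
  shows "joint_kernel_adj d (prod_verts d V) (multishift d V E c) =
    {g \<in> l2 (prod_verts d V).
       \<forall>j\<in>{1..d}. \<forall>v\<in>prod_verts d V. (\<Sum>w\<in>Chi_prod d V E j v. g w) = 0}"
proof -
  let ?X = "prod_verts d V"
  obtain M where M: "c n \<le> M" for n using bdd by (auto simp: bdd_above_def)
  then have M0: "0 \<le> M" using pos by (meson less_imp_le order.trans)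
  have "l2_adjoint ?X (multishift d V E c j) g = 0 \<longleftrightarrow>
      (\<forall>v\<in>?X. (\<Sum>w\<in>Chi_prod d V E j v. g w) = 0)"
    if j: "j \<in> {1..d}" and g: "g \<in> l2 ?X" for j g
  proof -
    define l where "l v = sqrt (c (total_depth d V E v) / real (card (Chi_prod d V E j v))) *
      sqrt ((real (depth (V j) (E j) (v j)) + 1) / (real (total_depth d V E v) + real d))" for v
    have weight: "weight d V E c j w = l v" if "v \<in> ?X" "w \<in> Chi_prod d V E j v" for v w
      unfolding weight_def Let_def parent_of_Chi_prod[OF that(1) j that(2)] l_def ..
    \<comment> \<open>Without children the sum is empty, so the value of \<open>l v\<close> is
      irrelevant there.\<close>
    have l_pos: "l v \<noteq> 0" if "v \<in> ?X" "Chi_prod d V E j v \<noteq> {}" for v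
    proof -
      have "card (Chi_prod d V E j v) \<noteq> 0" using that finite_Chi_prod[OF _ j] by simp
      then show ?thesis using pos[of "total_depth d V E v"] j by (auto simp: l_def)
    qed
    have bound: "(\<Sum>w\<in>Chi_prod d V E j v. (weight d V E c j w)\<^sup>2) \<le> M" if v: "v \<in> ?X" for v
    proof (cases "card (Chi_prod d V E j v) = 0")
      case True
      then show ?thesis using finite_Chi_prod[OF v j] M0 by simp
    next
      case False
      have "depth (V j) (E j) (v j) \<le> total_depth d V E v"
        unfolding total_depth_def using j by (intro member_le_sum) auto
      \<comment> \<open>The \<open>+ 1\<close> in the numerator is absorbed by \<open>d\<close>,
        which is at least 1 because \<open>j\<close> lies in \<open>{1..d}\<close>.\<close>
      then have ratio: "(real (depth (V j) (E j) (v j)) + 1) / (real (total_depth d V E v) + real d) \<le> 1"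
        using j by auto
      \<comment> \<open>The number of equal terms cancels the cardinality in the weight.\<close>
      have "(\<Sum>w\<in>Chi_prod d V E j v. (weight d V E c j w)\<^sup>2) = real (card (Chi_prod d V E j v)) * (l v)\<^sup>2"
        using weight[OF v] by simp
      also have "\<dots> = c (total_depth d V E v) *
          ((real (depth (V j) (E j) (v j)) + 1) / (real (total_depth d V E v) + real d))"
        using False pos[of "total_depth d V E v"] by (simp add: l_def power_mult_distrib)
      also have "\<dots> \<le> c (total_depth d V E v) * 1"
        using ratio pos[of "total_depth d V E v"] by (intro mult_left_mono) auto
      finally show ?thesis using M[of "total_depth d V E v"] by simp
    qed
    have "l2_adjoint ?X (multishift d V E c j) g =
        (\<lambda>v. if v \<in> ?X then \<Sum>w\<in>Chi_prod d V E j v. complex_of_real (weight d V E c j w) * g w else 0)"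
      unfolding multishift_def
    proof (rule l2_adjoint_weighted_shift[OF _ _ bound g])
      show "finite (Chi_prod d V E j v) \<and> Chi_prod d V E j v \<subseteq> ?X" if "v \<in> ?X" for v
        using finite_Chi_prod[OF that j] by (auto simp: Chi_prod_def)
      show "Chi_prod d V E j u \<inter> Chi_prod d V E j v = {}" if "u \<in> ?X" "v \<in> ?X" "u \<noteq> v" for u v
        using that parent_of_Chi_prod[OF _ j] by blast
    qed
    also have "\<dots> = (\<lambda>v. if v \<in> ?X then complex_of_real (l v) * (\<Sum>w\<in>Chi_prod d V E j v. g w) else 0)"
      by (auto simp: weight sum_distrib_left intro!: ext sum.cong)
    finally show ?thesis using l_pos by (force simp: fun_eq_iff)
  qed
  then show ?thesis by (auto simp: joint_kernel_adj_def)
qed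

section \<open>Vanishing child sums and the tensor product basis\<close>

definition sum_free :: "((nat \<Rightarrow> 'a) \<Rightarrow> complex) \<Rightarrow> bool" where
  "sum_free g \<longleftrightarrow> (\<forall>x. x \<notin> prod_verts d V \<longrightarrow> g x = 0) \<and>
     (\<forall>j\<in>{1..d}. \<forall>v\<in>prod_verts d V. (\<Sum>w\<in>Chi_prod d V E j v. g w) = 0)"

definition free_prod :: "(nat \<Rightarrow> 'a) set" where
  "free_prod = (\<Pi>\<^sub>E j\<in>{1..d}. free_verts (V j) (E j))"

text \<open>For free \<open>x\<close> this is one tensor factor: the point mass at \<open>x\<close>
  minus the one at its representative, or just the point mass if \<open>x\<close> is the
  root.\<close>

definition coord_fun :: "nat \<Rightarrow> 'a \<Rightarrow> 'a \<Rightarrow> complex" where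
  "coord_fun j x y = (if y = x then 1 else if x \<noteq> root (V j) (E j) \<and> y = rep (E j) x then - 1 else 0)"

text \<open>The explicit zero is needed because the product ignores values of \<open>w\<close>
  outside \<open>{1..d}\<close> and so does not detect a failure of extensionality.\<close>

definition basis_fun :: "(nat \<Rightarrow> 'a) \<Rightarrow> (nat \<Rightarrow> 'a) \<Rightarrow> complex" where
  "basis_fun b w = (if w \<in> prod_verts d V then \<Prod>j\<in>{1..d}. coord_fun j (b j) (w j) else 0)"

lemma free_prod_subset: "free_prod \<subseteq> prod_verts d V"
  by (auto simp: free_prod_def prod_verts_def free_verts_def PiE_iff)

text \<open>Induction on the number of non-free coordinates. If \<open>w j\<close> is a
  representative, replacing it by any other sibling gives one more free coordinate, so in the
  vanishing sum over these siblings only \<open>h w\<close> survives. The argument is algebraic and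
  works for all \<open>sum_free\<close> functions.\<close>

lemma sum_free_unique:
  assumes h: "sum_free h" and zero: "\<And>b. b \<in> free_prod \<Longrightarrow> h b = 0"
  shows "h w = 0"
proof (cases "w \<in> prod_verts d V")
  case True
  then show ?thesis
  proof (induction "card {j\<in>{1..d}. w j \<notin> free_verts (V j) (E j)}" arbitrary: w rule: less_induct)
    case less
    show ?case
    proof (cases "w \<in> free_prod")
      case False
      then obtain j where j: "j \<in> {1..d}" "w j \<notin> free_verts (V j) (E j)"
        using less.prems by (auto simp: free_prod_def prod_verts_def PiE_iff)
      interpret locally_finite_tree "V j" "E j" by (rule trees[OF j(1)])
      have wj: "w j \<in> V j" using coord_in_verts less.prems j by blast
      with j have nonroot: "w j \<noteq> root (V j) (E j)" and rep: "rep (E j) (w j) = w j"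
        by (auto simp: free_verts_def)
      \<comment> \<open>Moving coordinate \<open>j\<close> to its parent gives a vertex that has
        \<open>w\<close> among its \<open>j\<close>-children.\<close>
      let ?p = "par (E j) (w j)"
      have p: "(?p, w j) \<in> E j" by (rule par_edge[OF wj nonroot])
      then have v: "w(j := ?p) \<in> prod_verts d V"
        using fun_upd_in_verts less.prems j edge_in_verts by blast
      have sibs: "h (w(j := y)) = 0" if y: "y \<in> sib (E j) (w j) - {w j}" for y
      proof (rule less.hyps)
        have y': "y \<in> V j" "y \<noteq> root (V j) (E j)" "rep (E j) y = w j"
          using in_sib[OF wj nonroot] rep_sib[OF wj nonroot] y rep by auto
        then show "w(j := y) \<in> prod_verts d V" using fun_upd_in_verts less.prems j by blast
        have "y \<in> free_verts (V j) (E j)" using y y' by (auto simp: free_verts_def)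
        then have "{i \<in> {1..d}. (w(j := y)) i \<notin> free_verts (V i) (E i)} \<subset>
            {i \<in> {1..d}. w i \<notin> free_verts (V i) (E i)}"
          using j by (auto split: if_splits)
        then show "card {i \<in> {1..d}. (w(j := y)) i \<notin> free_verts (V i) (E i)} <
            card {i \<in> {1..d}. w i \<notin> free_verts (V i) (E i)}"
          by (intro psubset_card_mono) auto
      qed
      have "0 = (\<Sum>u\<in>Chi_prod d V E j (w(j := ?p)). h u)"
        using h v j by (simp add: sum_free_def)
      also have "\<dots> = (\<Sum>y\<in>sib (E j) (w j). h (w(j := y)))"
        using sum_Chi_prod[OF v j(1)] by (simp add: sib_def)
      also have "\<dots> = h w"
        using sibs finite_sib[OF wj nonroot] self_in_sib[OF wj nonroot]
        by (simp add: sum.remove)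
      finally show ?thesis by simp
    qed (rule zero)
  qed
qed (use h in \<open>simp add: sum_free_def\<close>)

text \<open>In a coordinate where \<open>w\<close> and \<open>b\<close> differ, the factor could be
  nonzero only at the representative of \<open>b j\<close>, which is not free.\<close>

lemma basis_fun_free_prod:
  assumes b: "b \<in> free_prod" and w: "w \<in> free_prod"
  shows "basis_fun b w = (if w = b then 1 else 0)"
proof (cases "w = b")
  case True
  then show ?thesis using free_prod_subset b by (auto simp: basis_fun_def coord_fun_def)
next
  case False
  then obtain j where j: "j \<in> {1..d}" "w j \<noteq> b j"
    using b w PiE_ext[of w _ _ b] unfolding free_prod_def by blast
  interpret locally_finite_tree "V j" "E j" by (rule trees[OF j(1)])
  have free: "b j \<in> free_verts (V j) (E j)" "w j \<in> free_verts (V j) (E j)"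
    using b w j by (auto simp: free_prod_def)
  have "coord_fun j (b j) (w j) = 0"
  proof (rule ccontr)
    assume "coord_fun j (b j) (w j) \<noteq> 0"
    then have bj: "b j \<noteq> root (V j) (E j)" "w j = rep (E j) (b j)"
      using j by (auto simp: coord_fun_def split: if_splits)
    have bV: "b j \<in> V j" using free by (simp add: free_verts_def)
    have "w j \<in> sib (E j) (b j)" using rep_in_sib[OF bV bj(1)] bj(2) by simp
    then have "rep (E j) (w j) = w j" "w j \<noteq> root (V j) (E j)"
      using rep_sib[OF bV bj(1)] in_sib[OF bV bj(1)] bj(2) by auto
    then show False using free by (simp add: free_verts_def)
  qed
  then have "(\<Prod>j\<in>{1..d}. coord_fun j (b j) (w j)) = 0"
    using j(1) by (intro prod_zero) auto
  then show ?thesis using False by (simp add: basis_fun_def)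
qed

text \<open>A non-root \<open>b\<close> and its representative have the same parent, so a set of
  children contains both, contributing 1 - 1, or neither. The root is nobody's child.\<close>

lemma sum_coord_fun:
  assumes j: "j \<in> {1..d}" and x: "x \<in> V j" and b: "b \<in> free_verts (V j) (E j)"
  shows "(\<Sum>y\<in>Chi (E j) x. coord_fun j b y) = 0"
proof -
  interpret locally_finite_tree "V j" "E j" by (rule trees[OF j])
  have bV: "b \<in> V j" using b by (simp add: free_verts_def)
  show ?thesis
  proof (cases "b \<in> Chi (E j) x")
    case True
    then have nonroot: "b \<noteq> root (V j) (E j)" using no_parent_root by (auto simp: Chi_def)
    then have ne: "b \<noteq> rep (E j) b" using b by (simp add: free_verts_def)
    have "sib (E j) b = Chi (E j) x" using True sib_child by (simp add: Chi_def)
    then have rep: "rep (E j) b \<in> Chi (E j) x" using rep_in_sib[OF bV nonroot] by simp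
    have "(\<Sum>y\<in>Chi (E j) x. coord_fun j b y) = (\<Sum>y\<in>{b, rep (E j) b}. coord_fun j b y)"
      using True rep finite_Chi[OF x] by (intro sum.mono_neutral_right) (auto simp: coord_fun_def)
    also have "\<dots> = 0" using ne nonroot by (auto simp: coord_fun_def)
    finally show ?thesis .
  next
    case False
    have "rep (E j) b \<notin> Chi (E j) x" if nonroot: "b \<noteq> root (V j) (E j)"
    proof
      assume "rep (E j) b \<in> Chi (E j) x"
      then have "sib (E j) (rep (E j) b) = Chi (E j) x" using sib_child by (simp add: Chi_def)
      then show False
        using False in_sib(3)[OF bV nonroot rep_in_sib[OF bV nonroot]] self_in_sib[OF bV nonroot]
        by simp
    qed
    then show ?thesis using False by (intro sum.neutral) (auto simp: coord_fun_def)
  qed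
qed

text \<open>Along \<open>Chi_prod d V E j v\<close> only the factor for \<open>j\<close> varies, so
  the sum factors through \<open>sum_coord_fun\<close>.\<close>

lemma sum_free_basis_fun:
  assumes b: "b \<in> free_prod"
  shows "sum_free (basis_fun b)"
  unfolding sum_free_def
proof (intro conjI ballI allI impI)
  fix j v assume j: "j \<in> {1..d}" and v: "v \<in> prod_verts d V"
  have split: "basis_fun b (v(j := y)) = coord_fun j (b j) y * (\<Prod>i\<in>{1..d}-{j}. coord_fun i (b i) (v i))"
    if "y \<in> Chi (E j) (v j)" for y
  proof -
    have "y \<in> V j" using that rooted_tree.edge_in_verts[OF trees'[OF j]] by (auto simp: Chi_def)
    then show ?thesis
      using fun_upd_in_verts[OF v j] j by (simp add: basis_fun_def prod.remove)
  qed
  have "(\<Sum>w\<in>Chi_prod d V E j v. basis_fun b w) =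
      (\<Sum>y\<in>Chi (E j) (v j). coord_fun j (b j) y) * (\<Prod>i\<in>{1..d}-{j}. coord_fun i (b i) (v i))"
    unfolding sum_Chi_prod[OF v j] sum_distrib_right by (intro sum.cong split refl)
  also have "\<dots> = 0"
    using sum_coord_fun[OF j] coord_in_verts[OF v j] b j by (simp add: free_prod_def PiE_iff)
  finally show "(\<Sum>w\<in>Chi_prod d V E j v. basis_fun b w) = 0" .
qed (simp add: basis_fun_def)

text \<open>The support is finite: each coordinate has at most two admissible values.\<close>

lemma basis_fun_in_l2:
  assumes b: "b \<in> free_prod"
  shows "basis_fun b \<in> l2 (prod_verts d V)"
proof (rule finite_support_in_l2)
  have "{w. basis_fun b w \<noteq> 0} \<subseteq> (\<Pi>\<^sub>E j\<in>{1..d}. {b j, rep (E j) (b j)})"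
    by (auto simp: basis_fun_def coord_fun_def prod_verts_def PiE_iff extensional_def split: if_splits)
  then show "finite {w. basis_fun b w \<noteq> 0}"
    by (rule finite_subset) (auto intro: finite_PiE)
qed (auto simp: basis_fun_def)

lemma cdimension_sum_free:
  assumes fin: "finite free_prod"
  shows "cdimension {g \<in> l2 (prod_verts d V).
    \<forall>j\<in>{1..d}. \<forall>v\<in>prod_verts d V. (\<Sum>w\<in>Chi_prod d V E j v. g w) = 0} = enat (card free_prod)"
    (is "cdimension ?K = _")
proof -
  have sum_app: "(\<Sum>b\<in>A. f b) w = (\<Sum>b\<in>A. f b w)"
    for A and f :: "(nat \<Rightarrow> 'a) \<Rightarrow> (nat \<Rightarrow> 'a) \<Rightarrow> complex" and w
    by (induction A rule: infinite_finite_induct) auto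
  let ?B = "basis_fun ` free_prod"
  have inj: "inj_on basis_fun free_prod"
    by (rule inj_onI) (metis basis_fun_free_prod zero_neq_one)
  \<comment> \<open>Evaluation on \<open>free_prod\<close> reads off the coefficients; this serves
    both spanning and independence.\<close>
  have comb: "(\<Sum>b\<in>free_prod. cscale (a b) (basis_fun b)) w = a w" if "w \<in> free_prod" for a w
  proof -
    have "(\<Sum>b\<in>free_prod. cscale (a b) (basis_fun b)) w = (\<Sum>b\<in>free_prod. if w = b then a b else 0)"
      unfolding sum_app using that by (intro sum.cong) (auto simp: cscale_def basis_fun_free_prod)
    then show ?thesis using fin that by simp
  qed
  have sub: "?B \<subseteq> ?K"
    using sum_free_basis_fun basis_fun_in_l2 by (auto simp: sum_free_def)
  have span: "?K \<subseteq> cfun.span ?B"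
  proof
    fix g assume g: "g \<in> ?K"
    \<comment> \<open>The only possible expansion of \<open>g\<close>: it agrees with
      \<open>g\<close> on \<open>free_prod\<close>, hence everywhere by
      \<open>sum_free_unique\<close>.\<close>
    define h where "h = (\<Sum>b\<in>free_prod. cscale (g b) (basis_fun b))"
    have "sum_free (\<lambda>w. g w - h w)"
      unfolding sum_free_def
    proof (intro conjI allI impI ballI)
      show "g x - h x = 0" if "x \<notin> prod_verts d V" for x
        using l2_D[of g "prod_verts d V" x] g that by (simp add: h_def sum_app cscale_def basis_fun_def)
      show "(\<Sum>w\<in>Chi_prod d V E j v. g w - h w) = 0" if j: "j \<in> {1..d}" and v: "v \<in> prod_verts d V" for j v
      proof -
        have "(\<Sum>w\<in>Chi_prod d V E j v. h w) =
            (\<Sum>b\<in>free_prod. g b * (\<Sum>w\<in>Chi_prod d V E j v. basis_fun b w))"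
          unfolding h_def sum_app cscale_def sum_distrib_left by (rule sum.swap)
        also have "\<dots> = 0"
          using sum_free_basis_fun j v by (intro sum.neutral) (simp add: sum_free_def)
        finally show ?thesis using g j v by (simp add: sum_subtractf)
      qed
    qed
    moreover have "g b - h b = 0" if "b \<in> free_prod" for b
      using comb[OF that] by (simp add: h_def)
    ultimately have "g w - h w = 0" for w by (rule sum_free_unique)
    then have "g = h" by auto
    then show "g \<in> cfun.span ?B"
      unfolding h_def by (metis (no_types, lifting) cfun.span_sum cfun.span_scale cfun.span_base imageI)
  qed
  have indep: "cfun.independent ?B"
  proof (rule cfun.independent_if_scalars_zero)
    fix a x assume zero: "(\<Sum>x\<in>?B. cscale (a x) x) = 0" and x: "x \<in> ?B"
    then obtain w where w: "w \<in> free_prod" "x = basis_fun w" by blast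
    have "(\<Sum>b\<in>free_prod. cscale (a (basis_fun b)) (basis_fun b)) w = 0"
      using zero inj by (simp add: sum.reindex)
    then show "a x = 0" using comb[OF w(1)] w(2) by simp
  qed (use fin in simp)
  have "cfun.dim ?K = card free_prod"
    by (rule cfun.dim_unique[OF sub span indep]) (rule card_image[OF inj])
  \<comment> \<open>Selects the finite case in \<open>cdimension\<close>.\<close>
  moreover have "\<exists>B. finite B \<and> ?K \<subseteq> cfun.span B"
    using span fin by (intro exI[of _ ?B] conjI finite_imageI)
  ultimately show ?thesis by (simp only: cdimension_def if_True)
qed

end

subsection \<open>Counting the basis\<close>

context tree_product
begin

lemma self_in_sib_prod:
  assumes "u \<in> Phi d V E F"
  shows "u \<in> sib_prod d V E F u"
  using assms rooted_tree.self_in_sib[OF trees'] coord_in_verts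
  by (auto simp: Phi_def sib_prod_def)

lemma sib_prod_Phi:
  assumes u: "u \<in> Phi d V E F" and w: "w \<in> sib_prod d V E F u"
  shows "w \<in> Phi d V E F" and "sib_prod d V E F w = sib_prod d V E F u"
proof -
  have coords: "w j \<noteq> root (V j) (E j) \<and> sib (E j) (w j) = sib (E j) (u j)"
    if "j \<in> {1..d}" "j \<in> F" for j
    using that u w rooted_tree.in_sib[OF trees'[OF that(1)], of "u j" "w j"]
    by (auto simp: Phi_def sib_prod_def coord_in_verts)
  show "w \<in> Phi d V E F" using coords u w by (auto simp: Phi_def sib_prod_def)
  show "sib_prod d V E F w = sib_prod d V E F u" using coords w by (auto simp: sib_prod_def)
qed

text \<open>The condition splits by coordinates: for \<open>j\<close> in \<open>F\<close> a sibling
  of \<open>u j\<close> is free iff it is not the common representative; for other \<open>j\<close>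
  the coordinate is fixed at the root, which is free.\<close>

lemma free_prod_sib_prod:
  assumes u: "u \<in> Phi d V E F"
  shows "free_prod \<inter> sib_prod d V E F u =
    (\<Pi>\<^sub>E j\<in>{1..d}. if j \<in> F then sib (E j) (u j) - {rep (E j) (u j)} else {root (V j) (E j)})"
    (is "_ = ?P")
proof -
  have in_F: "w \<in> free_verts (V j) (E j) \<and> w \<in> sib (E j) (u j) \<longleftrightarrow>
      w \<in> sib (E j) (u j) - {rep (E j) (u j)}"
    if j: "j \<in> {1..d}" "j \<in> F" for j w
  proof -
    interpret locally_finite_tree "V j" "E j" by (rule trees[OF j(1)])
    have uj: "u j \<in> V j" "u j \<noteq> root (V j) (E j)"
      using u j coord_in_verts by (auto simp: Phi_def)
    show ?thesis using in_sib[OF uj, of w] rep_sib[OF uj, of w] by (auto simp: free_verts_def)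
  qed
  have not_in_F: "u j = root (V j) (E j) \<and> root (V j) (E j) \<in> free_verts (V j) (E j)"
    if "j \<in> {1..d}" "j \<notin> F" for j
    using that u rooted_tree.root_free[OF trees'] by (auto simp: Phi_def)
  have "w \<in> free_prod \<inter> sib_prod d V E F u \<longleftrightarrow> w \<in> ?P" for w
  proof -
    have "w \<in> free_prod \<inter> sib_prod d V E F u \<longleftrightarrow> w \<in> extensional {1..d} \<and>
        (\<forall>j\<in>{1..d}. w j \<in> free_verts (V j) (E j) \<and> (j \<in> F \<longrightarrow> w j \<in> sib (E j) (u j)) \<and> (j \<notin> F \<longrightarrow> w j = u j))"
      using free_prod_subset by (auto simp: sib_prod_def prod_verts_def free_prod_def free_verts_def PiE_iff)
    also have "\<dots> \<longleftrightarrow> w \<in> extensional {1..d} \<and>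
        (\<forall>j\<in>{1..d}. w j \<in> (if j \<in> F then sib (E j) (u j) - {rep (E j) (u j)} else {root (V j) (E j)}))"
      using in_F not_in_F by (intro conj_cong ball_cong refl) auto
    finally show ?thesis by (simp only: PiE_iff conj_commute)
  qed
  then show ?thesis by blast
qed

lemma card_free_prod_sib_prod:
  assumes u: "u \<in> Phi d V E F" and F: "F \<subseteq> {1..d}"
  shows "card (free_prod \<inter> sib_prod d V E F u) = (\<Prod>i\<in>F. card (sib (E i) (u i)) - 1)"
proof -
  have "card (free_prod \<inter> sib_prod d V E F u) =
      (\<Prod>j\<in>{1..d}. if j \<in> F then card (sib (E j) (u j) - {rep (E j) (u j)}) else 1)"
    unfolding free_prod_sib_prod[OF u] by (auto simp: card_PiE intro!: prod.cong)
  also have "\<dots> = (\<Prod>j\<in>F. card (sib (E j) (u j) - {rep (E j) (u j)}))"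
    using F by (simp add: prod.If_cases Int_absorb1)
  also have "\<dots> = (\<Prod>j\<in>F. card (sib (E j) (u j)) - 1)"
  proof (rule prod.cong[OF refl])
    fix j assume j: "j \<in> F"
    then have d: "j \<in> {1..d}" using F by blast
    interpret locally_finite_tree "V j" "E j" by (rule trees[OF d])
    have uj: "u j \<in> V j" "u j \<noteq> root (V j) (E j)"
      using u j d coord_in_verts by (auto simp: Phi_def)
    show "card (sib (E j) (u j) - {rep (E j) (u j)}) = card (sib (E j) (u j)) - 1"
      using rep_in_sib[OF uj] by (rule card_Diff_singleton)
  qed
  finally show ?thesis .
qed

text \<open>\<open>\<Omega>\<close> may be infinite, but its classes are disjoint and only finitely
  many meet the finite set \<open>free_prod\<close>. The summand of \<open>u\<close> counts the
  points of \<open>free_prod\<close> in its class, so all other summands are 0.\<close>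

lemma infsum_Omega:
  assumes fin: "finite free_prod" and F: "F \<subseteq> {1..d}" and Om: "is_Omega d V E F \<Omega>"
  shows "(\<Sum>\<^sub>\<infinity>u\<in>\<Omega>. enat (\<Prod>i\<in>F. card (sib (E i) (u i)) - 1)) = enat (card (free_prod \<inter> Phi d V E F))"
proof -
  let ?C = "\<lambda>u. free_prod \<inter> sib_prod d V E F u"
  define \<Omega>' where "\<Omega>' = {u\<in>\<Omega>. ?C u \<noteq> {}}"
  have Phi: "u \<in> Phi d V E F" if "u \<in> \<Omega>" for u
    using Om that by (auto simp: is_Omega_def)
  have ex1: "\<exists>!u. u \<in> \<Omega> \<and> u \<in> sib_prod d V E F w" if "w \<in> Phi d V E F" for w
    using Om that by (auto simp: is_Omega_def)
  have sym: "w \<in> Phi d V E F \<and> u \<in> sib_prod d V E F w" if "u \<in> \<Omega>" "w \<in> sib_prod d V E F u" for u w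
    using sib_prod_Phi[OF Phi[OF that(1)] that(2)] self_in_sib_prod[OF Phi[OF that(1)]] by auto
  have disj: "?C u \<inter> ?C v = {}" if "u \<in> \<Omega>" "v \<in> \<Omega>" "u \<noteq> v" for u v
    using that sym ex1 by blast
  have "(\<Union>u\<in>\<Omega>'. ?C u) = free_prod \<inter> Phi d V E F"
  proof (intro equalityI subsetI)
    fix w assume w: "w \<in> free_prod \<inter> Phi d V E F"
    then obtain u where u: "u \<in> \<Omega>" "u \<in> sib_prod d V E F w" using ex1 by blast
    then have "w \<in> sib_prod d V E F u"
      using w sib_prod_Phi(2)[of w F u] self_in_sib_prod[of w F] by auto
    then show "w \<in> (\<Union>u\<in>\<Omega>'. ?C u)" using u w by (auto simp: \<Omega>'_def)
  qed (use sym in \<open>auto simp: \<Omega>'_def\<close>)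
  moreover have fin': "finite \<Omega>'"
  proof (rule inj_on_finite)
    \<comment> \<open>Disjoint nonempty sets are distinct, so \<open>\<Omega>'\<close> embeds into
      the subsets of \<open>free_prod\<close>.\<close>
    show "inj_on ?C \<Omega>'" using disj by (fastforce simp: inj_on_def \<Omega>'_def)
    show "?C ` \<Omega>' \<subseteq> Pow free_prod" by blast
  qed (use fin in simp)
  ultimately have card: "card (free_prod \<inter> Phi d V E F) = (\<Sum>u\<in>\<Omega>'. card (?C u))"
    using fin disj card_UN_disjoint[of \<Omega>' ?C] by (auto simp: \<Omega>'_def)
  have "(\<Sum>\<^sub>\<infinity>u\<in>\<Omega>. enat (\<Prod>i\<in>F. card (sib (E i) (u i)) - 1)) = (\<Sum>\<^sub>\<infinity>u\<in>\<Omega>. enat (card (?C u)))"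
    using card_free_prod_sib_prod[OF Phi F] by (intro infsum_cong) simp
  also have "\<dots> = (\<Sum>\<^sub>\<infinity>u\<in>\<Omega>'. enat (card (?C u)))"
    by (intro infsum_cong_neutral) (auto simp: \<Omega>'_def zero_enat_def)
  also have "\<dots> = enat (card (free_prod \<inter> Phi d V E F))"
    using fin' card by (simp flip: of_nat_eq_enat)
  finally show ?thesis .
qed

text \<open>Every vertex lies in \<open>Phi d V E F\<close> for exactly one \<open>F\<close>, the
  set of its non-root coordinates.\<close>

lemma card_free_prod:
  assumes fin: "finite free_prod"
  shows "card free_prod = (\<Sum>F\<in>Pow {1..d}. card (free_prod \<inter> Phi d V E F))"
proof -
  have "free_prod = (\<Union>F\<in>Pow {1..d}. free_prod \<inter> Phi d V E F)"
  proof (intro equalityI subsetI)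
    fix w assume w: "w \<in> free_prod"
    show "w \<in> (\<Union>F\<in>Pow {1..d}. free_prod \<inter> Phi d V E F)"
    proof (rule UN_I)
      show "w \<in> free_prod \<inter> Phi d V E {j\<in>{1..d}. w j \<noteq> root (V j) (E j)}"
        using w free_prod_subset by (auto simp: Phi_def)
    qed blast
  qed blast
  moreover have "free_prod \<inter> Phi d V E F \<inter> (free_prod \<inter> Phi d V E G) = {}"
    if FG: "F \<in> Pow {1..d}" "G \<in> Pow {1..d}" "F \<noteq> G" for F G
  proof -
    obtain j where "j \<in> {1..d}" "j \<in> F \<longleftrightarrow> j \<notin> G" using FG by blast
    then show ?thesis by (auto simp: Phi_def)
  qed
  ultimately show ?thesis
    using fin card_UN_disjoint[of "Pow {1..d}" "\<lambda>F. free_prod \<inter> Phi d V E F"] by auto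
qed

text \<open>The tuple of roots is the only such vertex; it accounts for the leading 1 in the second
  formula.\<close>

lemma card_free_prod_Phi_empty: "card (free_prod \<inter> Phi d V E {}) = 1"
proof -
  have "free_prod \<inter> Phi d V E {} = (\<Pi>\<^sub>E j\<in>{1..d}. {root (V j) (E j)})"
    using rooted_tree.root_free[OF trees'] rooted_tree.root_in_verts[OF trees']
    by (auto simp: free_prod_def Phi_def prod_verts_def PiE_iff)
  then show ?thesis by (simp add: card_PiE)
qed

end

theorem corollary2p4:
  fixes d :: nat
    and V :: "nat \<Rightarrow> 'a set"
    and E :: "nat \<Rightarrow> 'a rel"
    and S :: "nat \<Rightarrow> ((nat \<Rightarrow> 'a) \<Rightarrow> complex) \<Rightarrow> ((nat \<Rightarrow> 'a) \<Rightarrow> complex)"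
    and \<Omega> :: "nat set \<Rightarrow> (nat \<Rightarrow> 'a) set"
  assumes "1 \<le> d"
    and "\<And>j. j \<in> {1..d} \<Longrightarrow> rooted_directed_tree (V j) (E j)"
    and "\<And>j. j \<in> {1..d} \<Longrightarrow> countable (V j) \<and> infinite (V j)"
    and "\<And>j. j \<in> {1..d} \<Longrightarrow> leafless (V j) (E j)"
    and "\<And>j. j \<in> {1..d} \<Longrightarrow> locally_finite (V j) (E j)"
    and "finite_joint_branching_index d V E"
    and "S \<in> multishift_family d V E"
    and "\<And>F. F \<in> Pow {1..d} \<Longrightarrow> is_Omega d V E F (\<Omega> F)"
  shows "cdimension (joint_kernel_adj d (prod_verts d V) S) =
           (\<Sum>F\<in>Pow {1..d}. \<Sum>\<^sub>\<infinity>u\<in>\<Omega> F. enat (\<Prod>i\<in>F. card (sib (E i) (u i)) - 1))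
       \<and> (\<Sum>F\<in>Pow {1..d}. \<Sum>\<^sub>\<infinity>u\<in>\<Omega> F. enat (\<Prod>i\<in>F. card (sib (E i) (u i)) - 1)) =
           1 + (\<Sum>F\<in>Pow {1..d} - {{}}. \<Sum>\<^sub>\<infinity>u\<in>\<Omega> F. enat (\<Prod>i\<in>F. card (sib (E i) (u i)) - 1))"
    (is "?dim = ?sum \<and> _ = 1 + ?sum'")
proof -
  interpret tree_product d V E
    using assms(2,5) by unfold_locales
  have fin: "finite free_prod"
    unfolding free_prod_def using assms(6) locally_finite_tree.finite_free_verts[OF trees]
    by (intro finite_PiE) (auto simp: finite_joint_branching_index_def)
  \<comment> \<open>Each infinite sum in \<open>enat\<close> is thereby a finite cardinality, and
    only finite counting remains.\<close>
  have summand: "(\<Sum>\<^sub>\<infinity>u\<in>\<Omega> F. enat (\<Prod>i\<in>F. card (sib (E i) (u i)) - 1)) =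
      enat (card (free_prod \<inter> Phi d V E F))" if "F \<in> Pow {1..d}" for F
    using infsum_Omega[OF fin _ assms(8)[OF that]] that by blast
  obtain c where c: "\<And>n. 0 < c n" "bdd_above (range c)" "S = multishift d V E c"
    using assms(7) by (auto simp: multishift_family_def)
  have "?dim = enat (card free_prod)"
    unfolding c(3) joint_kernel_multishift[OF c(1,2)] by (rule cdimension_sum_free[OF fin])
  also have "\<dots> = ?sum"
    unfolding card_free_prod[OF fin] using summand by (simp flip: of_nat_eq_enat)
  finally have "?dim = ?sum" .
  moreover have "?sum = 1 + ?sum'"
    using summand[of "{}"] card_free_prod_Phi_empty
    by (subst sum.remove[of _ "{}"]) (simp_all add: one_enat_def)
  ultimately show ?thesis by simp
qed

end
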